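(* Let $G$ be an acyclic ADT network over $\mathbb F_q$, and let $S$, $T$ be a source supernode and a destination supernode. Let $M=A(I-F)^{-1}B^T$ be the system matrix from the source processes $\mathcal X(S)$ to the destination outputs $\mathcal Z(T)$, viewed as a function of the coding coefficients. Then $$\mathrm{mincut}(S,T)=\min_{\Omega}\mathrm{rank}(G_\Omega)=\max_{\alpha,\beta,\epsilon}\mathrm{rank}(M).$$
   Context: ADT network model. $G=(\mathcal V,\mathcal E)$ is a directed acyclic network of supernodes $V$. Each supernode has input ports $I(V)$ and output ports $O(V)$, and edges go from output ports of one supernode to input ports of another. Linear coding over $\mathbb F_q$ works as follows. - The source $S$ has source processes $X(S,1),\dots,X(S,\mu(S))$. - An output port $e\in O(V)$ carries $Y(e)=\sum_{e'\in I(V)}\beta_{(e',e)}Y(e')$. At the source, $\sum_i\alpha_{(i,e)}X(S,i)$ is added. - An output port sends the same symbol on all of its outgoing edges. - An input port $e'$ receives $Y(e')=\sum_{(e,e')\in\mathcal E}Y(e)$, the sum taken over $\mathbb F_q$. - $T$ outputs $Z(T,k)=\sum_{e'\in I(T)}\epsilon_{(e',(T,k))}Y(e')$ for $k=1,\dots,\nu(T)$. Index the ports as $e_1,\dots,e_m$. The matrix $F$ is $m\times m$, with $F_{i,j}=1$ if $(e_i,e_j)\in\mathcal E$, $F_{i,j}=\beta_{(e_i,e_j)}$ if $e_i,e_j$ are an input and an output port of the same supernode, and $F_{i,j}=0$ otherwise. The matrix $A$ is $\mu(S)\times m$, with $A_{i,j}=\alpha_{(i,e_j)}$ for $e_j\in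 O(S)$ and $0$ otherwise. The matrix $B$ is $\nu(T)\times m$, with $B_{k,i}=\epsilon_{(e_i,(T,k))}$ for $e_i\in I(T)$ and $0$ otherwise. Then $\mathcal Z(T)=\mathcal X(S)M$ with $M=A(I-F)^{-1}B^T$. A cut is a partition $\mathcal V=\Omega\cup\Omega^c$ with $S\in\Omega$ and $T\in\Omega^c$. $G_\Omega$ is the $0$-$1$ incidence matrix of the bipartite graph formed by the edges from output ports of supernodes in $\Omega$ to input ports of supernodes in $\Omega^c$. $\mathrm{mincut}(S,T)$ denotes the ADT capacity $\min_\Omega\mathrm{rank}(G_\Omega)$.
   Formalization: The formal theorem assumes that mincut(S,T) is at most μ(S) and at most ν(T); without this the claim is false, since rank(M) ≤ min(μ(S), ν(T)), e.g. one edge from S to T with μ(S)=0 gives mincut 1 but rank(M)=0. *)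

theory Defs
  imports "Jordan_Normal_Form.DL_Rank" "Jordan_Normal_Form.Gauss_Jordan_Elimination"
begin

text \<open>ADT network. Supernodes form the finite set V. Ports are indexed 0..<m
  (the ports e_1..e_m); node i is the supernode owning port i, and is_in i
  says whether port i is an input port (otherwise it is an output port).
  E is the set of edges between ports, each going from an output port of one
  supernode to an input port of a different supernode. The network is
  acyclic on supernodes.\<close>

definition adt_network ::
  "'v set \<Rightarrow> nat \<Rightarrow> (nat \<Rightarrow> 'v) \<Rightarrow> (nat \<Rightarrow> bool) \<Rightarrow> (nat \<times> nat) set \<Rightarrow> bool" where
  "adt_network V m node is_in E \<longleftrightarrow>
     finite V \<and> (\<forall>i<m. node i \<in> V) \<and>
     E \<subseteq> {(i, j). i < m \<and> j < m \<and> \<not> is_in i \<and> is_in j \<and> node i \<noteq> node j} \<and>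
     acyclic {(node i, node j) | i j. (i, j) \<in> E}"

definition mrank :: "'a::field mat \<Rightarrow> nat" where
  "mrank A = vec_space.rank (dim_row A) A"

definition F_mat ::
  "nat \<Rightarrow> (nat \<Rightarrow> 'v) \<Rightarrow> (nat \<Rightarrow> bool) \<Rightarrow> (nat \<times> nat) set \<Rightarrow> (nat \<Rightarrow> nat \<Rightarrow> 'a::field) \<Rightarrow> 'a mat" where
  "F_mat m node is_in E \<beta> = mat m m (\<lambda>(i, j).
     if (i, j) \<in> E then 1
     else if is_in i \<and> \<not> is_in j \<and> node i = node j then \<beta> i j
     else 0)"

definition A_mat ::
  "nat \<Rightarrow> nat \<Rightarrow> (nat \<Rightarrow> 'v) \<Rightarrow> (nat \<Rightarrow> bool) \<Rightarrow> 'v \<Rightarrow> (nat \<Rightarrow> nat \<Rightarrow> 'a::field) \<Rightarrow> 'a mat" where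
  "A_mat mu m node is_in S \<alpha> = mat mu m (\<lambda>(i, j).
     if \<not> is_in j \<and> node j = S then \<alpha> i j else 0)"

definition B_mat ::
  "nat \<Rightarrow> nat \<Rightarrow> (nat \<Rightarrow> 'v) \<Rightarrow> (nat \<Rightarrow> bool) \<Rightarrow> 'v \<Rightarrow> (nat \<Rightarrow> nat \<Rightarrow> 'a::field) \<Rightarrow> 'a mat" where
  "B_mat nu m node is_in T \<epsilon> = mat nu m (\<lambda>(k, i).
     if is_in i \<and> node i = T then \<epsilon> i k else 0)"

definition system_matrix ::
  "nat \<Rightarrow> nat \<Rightarrow> nat \<Rightarrow> (nat \<Rightarrow> 'v) \<Rightarrow> (nat \<Rightarrow> bool) \<Rightarrow> (nat \<times> nat) set \<Rightarrow> 'v \<Rightarrow> 'v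
    \<Rightarrow> (nat \<Rightarrow> nat \<Rightarrow> 'a::field) \<Rightarrow> (nat \<Rightarrow> nat \<Rightarrow> 'a) \<Rightarrow> (nat \<Rightarrow> nat \<Rightarrow> 'a) \<Rightarrow> 'a mat" where
  "system_matrix mu nu m node is_in E S T \<alpha> \<beta> \<epsilon> =
     A_mat mu m node is_in S \<alpha>
     * the (mat_inverse (1\<^sub>m m - F_mat m node is_in E \<beta>))
     * transpose_mat (B_mat nu m node is_in T \<epsilon>)"

definition G_cut ::
  "'v set \<Rightarrow> nat \<Rightarrow> (nat \<Rightarrow> 'v) \<Rightarrow> (nat \<Rightarrow> bool) \<Rightarrow> (nat \<times> nat) set \<Rightarrow> 'v set \<Rightarrow> 'a::field mat" where
  "G_cut V m node is_in E \<Omega> =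
     (let rs = sorted_list_of_set {i. i < m \<and> \<not> is_in i \<and> node i \<in> \<Omega>};
          cs = sorted_list_of_set {j. j < m \<and> is_in j \<and> node j \<in> V - \<Omega>}
      in mat (length rs) (length cs) (\<lambda>(a, b). if (rs ! a, cs ! b) \<in> E then 1 else 0))"

definition adt_mincut ::
  "'a::field itself \<Rightarrow> 'v set \<Rightarrow> nat \<Rightarrow> (nat \<Rightarrow> 'v) \<Rightarrow> (nat \<Rightarrow> bool) \<Rightarrow> (nat \<times> nat) set \<Rightarrow> 'v \<Rightarrow> 'v \<Rightarrow> nat" where
  "adt_mincut _ V m node is_in E S T =
     Min {mrank (G_cut V m node is_in E \<Omega> :: 'a mat) | \<Omega>. \<Omega> \<subseteq> V \<and> S \<in> \<Omega> \<and> T \<notin> \<Omega>}"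

end

theory Submission
  imports Defs "HOL-Library.Function_Algebras"
begin

text \<open>The matrix with blocks I - F, B^T, -A and 0 has rank m + rank M, since I - F is invertible
  by acyclicity. Each coding coefficient occurs in exactly one entry of it, so maximising over the coefficients is a
  maximal rank completion problem. Over every field, the maximal rank of a matrix with free entries
  is the minimum of rank N[I, J] plus the number of rows outside I and of columns outside J, taken
  over all (I, J) for which N[I, J] contains no free entry (Hartfiel and Loewy). For the block matrix
  such a pair either misses all source or all destination coordinates, and then costs at least m + mu
  or m + nu, or it is dominated by a pair arising from a cut, whose cost is m + rank G.\<close>

section \<open>Dimensions of finite sets of vectors\<close>

lemma (in vector_space) dim_insert_finite:
  assumes "finite X"
  shows "dim (insert a X) = (if a \<in> span X then dim X else Suc (dim X))"
proof (cases "a \<in> span X")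
  case True
  then show ?thesis
    by (metis dim_span span_redundant)
next
  case False
  obtain B where B: "B \<subseteq> X" "independent B" "X \<subseteq> span B" "card B = dim X"
    using basis_exists by metis
  have fB: "finite B"
    using B(1) assms finite_subset by auto
  have sp: "span B = span X"
    using B by (meson span_minimal span_mono subset_antisym subspace_span)
  have "independent (insert a B)"
    using B False sp by (intro independent_insertI) auto
  moreover have "insert a X \<subseteq> span (insert a B)"
    using B(3) span_mono[of B "insert a B"] by (auto intro: span_base)
  ultimately have "dim (insert a X) = card (insert a B)"
    using B(1) by (intro dim_unique[of "insert a B"]) auto
  moreover have "a \<notin> B"
    using False sp span_base by auto
  ultimately show ?thesis
    using False B fB by simp
qed

lemma (in vector_space) dim_mono_finite:
  assumes "finite Y" and "X \<subseteq> span Y"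
  shows "dim X \<le> dim Y"
proof -
  obtain B where B: "B \<subseteq> Y" "independent B" "Y \<subseteq> span B" "card B = dim Y"
    using basis_exists by metis
  have "X \<subseteq> span B"
    using assms(2) B(3) span_minimal subspace_span by blast
  then show ?thesis
    using dim_le_card[of X B] B assms finite_subset by metis
qed

lemma (in vector_space) dim_Un_le:
  assumes "finite X" and "finite Y"
  shows "dim (X \<union> Y) \<le> dim X + card Y"
  using assms(2)
proof (induction Y)
  case empty
  then show ?case by simp
next
  case (insert a Y)
  then show ?case
    using dim_insert_finite[of "X \<union> Y" a] assms(1) by auto
qed

text \<open>Diminishing returns: a vector outside the span of a set is outside the span of every
  smaller set, so it raises the smaller dimension whenever it raises the larger one.\<close>

lemma (in vector_space) dim_submodular:
  assumes "finite X" and "finite Y"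
  shows "dim (X \<union> Y) + dim (X \<inter> Y) \<le> dim X + dim Y"
proof -
  \<comment> \<open>The induction keeps \<open>X \<inter> Y\<close> fixed while the adjoined set
    grows; for \<open>Z = Y\<close> the union on the right collapses to \<open>Y\<close>.\<close>
  have "dim (X \<union> Z) + dim (X \<inter> Y) \<le> dim X + dim ((X \<inter> Y) \<union> Z)" if "finite Z" for Z
    using that
  proof (induction Z)
    case empty
    then show ?case by simp
  next
    case (insert a Z)
    have "span ((X \<inter> Y) \<union> Z) \<subseteq> span (X \<union> Z)"
      by (intro span_mono) auto
    then show ?case
      using insert assms dim_insert_finite[of "X \<union> Z" a] dim_insert_finite[of "(X \<inter> Y) \<union> Z" a]
      by auto
  qed
  from this[of Y] show ?thesis
    using assms by (simp add: Un_absorb1)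
qed

text \<open>Column operations: \<open>z k\<close> and \<open>c k\<close> differ by an element of
  \<open>span X\<close>, so both unions have the same span. This serves below to clear coordinates
  and to eliminate a block.\<close>

lemma (in vector_space) dim_Un_replace:
  assumes "\<And>k. k \<in> D \<Longrightarrow> z k - c k \<in> span X"
  shows "dim (X \<union> z ` D) = dim (X \<union> c ` D)"
proof (intro span_eq_dim subset_antisym span_minimal subspace_span)
  have sub: "span X \<subseteq> span (X \<union> z ` D)" "span X \<subseteq> span (X \<union> c ` D)"
    by (intro span_mono Un_upper1)+
  have "z k \<in> span (X \<union> c ` D)" if "k \<in> D" for k
  proof -
    have "c k \<in> span (X \<union> c ` D)" "z k - c k \<in> span (X \<union> c ` D)"
      using that assms sub by (auto intro: span_base)
    then show ?thesis
      using span_add by fastforce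
  qed
  then show "X \<union> z ` D \<subseteq> span (X \<union> c ` D)"
    by (auto intro: span_base)
  have "c k \<in> span (X \<union> z ` D)" if "k \<in> D" for k
  proof -
    have "z k \<in> span (X \<union> z ` D)" "z k - c k \<in> span (X \<union> z ` D)"
      using that assms sub by (auto intro: span_base)
    then show ?thesis
      using span_diff by fastforce
  qed
  then show "X \<union> c ` D \<subseteq> span (X \<union> z ` D)"
    by (auto intro: span_base)
qed

text \<open>The subspaces U play the role of the kernels of a dual family of functionals.\<close>
lemma (in vector_space) dim_image_Un_dual:
  assumes "finite J" and "finite C"
    and "\<And>j. j \<in> J \<Longrightarrow> \<exists>U. subspace U \<and> v j \<notin> U \<and> v ` (J - {j}) \<subseteq> U \<and> C \<subseteq> U"
  shows "dim (v ` J \<union> C) = card J + dim C"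
  using assms(1,3)
proof (induction J)
  case empty
  then show ?case by simp
next
  case (insert j J)
  have "dim (v ` J \<union> C) = card J + dim C"
  proof (rule insert.IH)
    fix i assume "i \<in> J"
    then obtain U where "subspace U \<and> v i \<notin> U \<and> v ` (insert j J - {i}) \<subseteq> U \<and> C \<subseteq> U"
      using insert.prems by blast
    then show "\<exists>U. subspace U \<and> v i \<notin> U \<and> v ` (J - {i}) \<subseteq> U \<and> C \<subseteq> U"
      by blast
  qed
  moreover obtain U where U: "subspace U" "v j \<notin> U" "v ` (insert j J - {j}) \<subseteq> U" "C \<subseteq> U"
    using insert.prems by blast
  have "v ` J \<union> C \<subseteq> U"
    using U insert.hyps by auto
  then have "v j \<notin> span (v ` J \<union> C)"
    using U span_minimal by blast
  ultimately show ?case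
    using insert.hyps assms(2) dim_insert_finite[of "v ` J \<union> C" "v j"] by simp
qed

section \<open>Functions as vectors, and the deletion of coordinates\<close>

interpretation fun_vs: vector_space "\<lambda>(c::'a::field) (f::'c \<Rightarrow> 'a) x. c * f x"
  by unfold_locales (auto simp: fun_eq_iff algebra_simps)

definition unit_fun :: "'c \<Rightarrow> 'c \<Rightarrow> 'a::field" where
  "unit_fun k = (\<lambda>x. if x = k then 1 else 0)"

lemma fun_sum_apply: "sum f A x = (\<Sum>a\<in>A. f a x)"
  for f :: "'b \<Rightarrow> 'c \<Rightarrow> 'a::comm_monoid_add"
  by (induction A rule: infinite_finite_induct) auto

abbreviation vanish :: "'c set \<Rightarrow> ('c \<Rightarrow> 'a::field) \<Rightarrow> 'c \<Rightarrow> 'a" where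
  "vanish L f \<equiv> (\<lambda>x. if x \<in> L then 0 else f x)"

lemma vanish_diff_in_span:
  assumes "finite L"
  shows "f - vanish L f \<in> fun_vs.span (unit_fun ` L)"
proof -
  have "f - vanish L f = (\<Sum>l\<in>L. (\<lambda>x. f l * unit_fun l x))"
  proof
    fix x
    have "(\<Sum>l\<in>L. f l * unit_fun l x) = (if x \<in> L then f x else 0)"
      unfolding unit_fun_def using assms by (simp add: if_distrib cong: if_cong)
    then show "(f - vanish L f) x = (\<Sum>l\<in>L. (\<lambda>x. f l * unit_fun l x)) x"
      by (simp add: fun_sum_apply)
  qed
  also have "\<dots> \<in> fun_vs.span (unit_fun ` L)"
    by (intro fun_vs.span_sum fun_vs.span_scale fun_vs.span_base) auto
  finally show ?thesis .
qed

lemma subspace_vanish_at: "fun_vs.subspace {f. f x = 0}"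
  by (auto simp: fun_vs.subspace_def)

text \<open>Modulo the unit vectors of \<open>L\<close> every \<open>f\<close> equals
  \<open>vanish L f\<close>, and evaluation at the points of \<open>L\<close> is dual to these unit
  vectors. Adjoining unit vectors thus acts as deleting coordinates, up to the summand
  \<open>card L\<close>.\<close>

lemma dim_Un_units:
  fixes X :: "('c \<Rightarrow> 'a::field) set"
  assumes "finite X" and "finite L"
  shows "fun_vs.dim (X \<union> unit_fun ` L) = card L + fun_vs.dim (vanish L ` X)"
proof -
  have "fun_vs.dim (X \<union> unit_fun ` L) = fun_vs.dim (unit_fun ` L \<union> (\<lambda>f. f) ` X)"
    by (simp add: Un_commute)
  also have "\<dots> = fun_vs.dim (unit_fun ` L \<union> vanish L ` X)"
    by (rule fun_vs.dim_Un_replace) (rule vanish_diff_in_span[OF assms(2)])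
  also have "\<dots> = card L + fun_vs.dim (vanish L ` X)"
  proof (rule fun_vs.dim_image_Un_dual)
    fix j assume "j \<in> L"
    then show "\<exists>U. fun_vs.subspace U \<and> unit_fun j \<notin> U \<and> unit_fun ` (L - {j}) \<subseteq> U \<and> vanish L ` X \<subseteq> U"
      by (intro exI[of _ "{f. f j = 0}"] conjI subspace_vanish_at) (auto simp: unit_fun_def)
  qed (use assms in auto)
  finally show ?thesis .
qed

section \<open>Maximal rank of a partially specified matrix\<close>

text \<open>The rank of the minor with rows I and columns outside K, plus card K: adjoining the unit
  vectors of K instead of deleting columns turns the rank into a submodular function of I and K.\<close>
definition minor_dim :: "('r \<Rightarrow> 'c \<Rightarrow> 'a::field) \<Rightarrow> 'r set \<Rightarrow> 'c set \<Rightarrow> nat" where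
  "minor_dim x I K = fun_vs.dim (x ` I \<union> unit_fun ` K)"

lemma minor_dim_mono:
  assumes "I \<subseteq> I'" "K \<subseteq> K'" "finite I'" "finite K'"
  shows "minor_dim x I K \<le> minor_dim x I' K'"
  unfolding minor_dim_def using assms
  by (intro fun_vs.dim_mono_finite) (auto intro!: fun_vs.span_base)

lemma minor_dim_extend:
  assumes "I \<subseteq> I'" "finite I'" "finite K"
  shows "minor_dim x I' K \<le> minor_dim x I K + card (I' - I)"
proof -
  have "x ` I' \<union> unit_fun ` K = (x ` I \<union> unit_fun ` K) \<union> x ` (I' - I)"
    using assms by auto
  then have "minor_dim x I' K \<le> minor_dim x I K + card (x ` (I' - I))"
    unfolding minor_dim_def using assms fun_vs.dim_Un_le[of "x ` I \<union> unit_fun ` K" "x ` (I' - I)"]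
    by (simp add: finite_subset)
  also have "card (x ` (I' - I)) \<le> card (I' - I)"
    using assms by (intro card_image_le) auto
  finally show ?thesis by simp
qed

text \<open>Unions of index sets give unions of vectors exactly, but the vectors of the intersected
  index sets only lie inside the intersection, since distinct indices may carry the same vector.
  Monotonicity covers this gap in submodularity.\<close>

lemma minor_dim_uncross:
  assumes "finite I" "finite K" "finite I'" "finite K'"
  shows "minor_dim x (I \<union> I') (K \<union> K') + minor_dim x (I \<inter> I') (K \<inter> K') \<le> minor_dim x I K + minor_dim x I' K'"
proof -
  have "x ` (I \<union> I') \<union> unit_fun ` (K \<union> K') = (x ` I \<union> unit_fun ` K) \<union> (x ` I' \<union> unit_fun ` K')"
    by auto
  moreover have "minor_dim x (I \<inter> I') (K \<inter> K') \<le> fun_vs.dim ((x ` I \<union> unit_fun ` K) \<inter> (x ` I' \<union> unit_fun ` K'))"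
    unfolding minor_dim_def using assms
    by (intro fun_vs.dim_mono_finite) (auto intro!: fun_vs.span_base)
  ultimately show ?thesis
    using fun_vs.dim_submodular[of "x ` I \<union> unit_fun ` K" "x ` I' \<union> unit_fun ` K'"] assms
    unfolding minor_dim_def by simp
qed

text \<open>Coordinates in \<open>K\<close> are absorbed by the adjoined unit vectors, so free
  entries located there do not influence the value.\<close>

lemma minor_dim_cong:
  assumes "finite I" "finite K" and "\<And>i k. i \<in> I \<Longrightarrow> k \<notin> K \<Longrightarrow> x i k = y i k"
  shows "minor_dim x I K = minor_dim y I K"
proof -
  have "vanish K ` x ` I = vanish K ` y ` I"
    unfolding image_image using assms(3) by (intro image_cong refl) (auto simp: fun_eq_iff)
  then show ?thesis
    unfolding minor_dim_def using assms by (simp add: dim_Un_units)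
qed

definition agree_off :: "('r \<times> 'c) set \<Rightarrow> ('r \<Rightarrow> 'c \<Rightarrow> 'a) \<Rightarrow> ('r \<Rightarrow> 'c \<Rightarrow> 'a) \<Rightarrow> bool" where
  "agree_off P x y \<longleftrightarrow> (\<forall>i k. (i, k) \<notin> P \<longrightarrow> x i k = y i k)"

text \<open>If row \<open>i\<close> lay in the span of the rest both before and after adding
  \<open>unit_fun j\<close>, the difference \<open>unit_fun j\<close> would lie there too. Two
  values of one entry therefore suffice, which works over every field.\<close>

lemma toggle_entry_rank:
  fixes x :: "'r \<Rightarrow> 'c \<Rightarrow> 'a::field" and j :: 'c
  assumes "finite R" "finite K" "i \<in> R"
  defines "y \<equiv> x(i := x i + unit_fun j)"
  shows "minor_dim x (R - {i}) (insert j K) \<le> minor_dim x R K \<or>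
         minor_dim x (R - {i}) (insert j K) \<le> minor_dim y R K"
proof -
  define W where "W = x ` (R - {i}) \<union> unit_fun ` K"
  have fW: "finite W"
    unfolding W_def using assms by auto
  have x: "minor_dim x R K = fun_vs.dim (insert (x i) W)"
    unfolding minor_dim_def W_def using assms by (intro arg_cong[of _ _ fun_vs.dim]) auto
  have "x ` (R - {i}) = y ` (R - {i})"
    unfolding y_def by auto
  then have "y ` R \<union> unit_fun ` K = insert (y i) W"
    unfolding W_def using assms(3) by auto
  moreover have "y i = x i + unit_fun j"
    by (simp add: y_def)
  ultimately have y: "minor_dim y R K = fun_vs.dim (insert (x i + unit_fun j) W)"
    unfolding minor_dim_def by (simp only:)
  have d: "minor_dim x (R - {i}) (insert j K) = fun_vs.dim (insert (unit_fun j) W)"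
    unfolding minor_dim_def W_def by (intro arg_cong[of _ _ fun_vs.dim]) auto
  have "unit_fun j \<in> fun_vs.span W" if "x i \<in> fun_vs.span W" "x i + unit_fun j \<in> fun_vs.span W"
    using fun_vs.span_diff[OF that(2,1)] by simp
  then show ?thesis
    unfolding x y d using fun_vs.dim_insert_finite[OF fW] by auto
qed

text \<open>Induction on the number of free entries: if the minor without row i and column j attains rank r,
  then some value of the free entry (i, j) yields rank r + 1. The optimal pairs for this minor and for the
  matrix with (i, j) frozen are then uncrossed by submodularity.\<close>
lemma max_rank_completion:
  fixes N :: "'r \<Rightarrow> 'c \<Rightarrow> 'a::field"
  assumes "finite P" "finite R" "finite K\<^sub>0"
  shows "\<exists>x I K. agree_off P x N \<and> I \<subseteq> R \<and> K\<^sub>0 \<subseteq> K \<and> finite K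
           \<and> (\<forall>(i, k) \<in> P. i \<in> I \<longrightarrow> k \<in> K)
           \<and> minor_dim N I K + card (R - I) \<le> minor_dim x R K\<^sub>0"
  using assms
proof (induction P arbitrary: R K\<^sub>0)
  case empty
  then show ?case
    by (intro exI[of _ N] exI[of _ R] exI[of _ K\<^sub>0]) (auto simp: agree_off_def)
next
  case (insert p P R K\<^sub>0)
  obtain i j where p: "p = (i, j)" by force
  \<comment> \<open>An optimal pair when the entry \<open>p\<close> stays frozen at its value in
    \<open>N\<close>. Only if its minor contains \<open>p\<close> does it fail for the larger set of
    free entries.\<close>
  obtain x1 I1 K1 where 1: "agree_off P x1 N" "I1 \<subseteq> R" "K\<^sub>0 \<subseteq> K1" "finite K1"
    "\<forall>(i, k) \<in> P. i \<in> I1 \<longrightarrow> k \<in> K1" "minor_dim N I1 K1 + card (R - I1) \<le> minor_dim x1 R K\<^sub>0"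
    using insert.IH[of R K\<^sub>0] insert.prems by blast
  have a1: "agree_off (insert p P) x1 N"
    using 1(1) by (auto simp: agree_off_def)
  show ?case
  proof (cases "i \<in> I1 \<and> j \<notin> K1")
    case False
    then show ?thesis
      using 1 a1 p by (intro exI[of _ x1] exI[of _ I1] exI[of _ K1]) auto
  next
    case True
    then have iR: "i \<in> R" using 1 by auto
    \<comment> \<open>The second use of the hypothesis drops row \<open>i\<close> and adjoins
      coordinate \<open>j\<close>, so that \<open>p\<close> is avoided in both directions.\<close>
    obtain x3 I3 K3 where 3: "agree_off P x3 N" "I3 \<subseteq> R - {i}" "insert j K\<^sub>0 \<subseteq> K3" "finite K3"
      "\<forall>(i, k) \<in> P. i \<in> I3 \<longrightarrow> k \<in> K3"
      "minor_dim N I3 K3 + card (R - {i} - I3) \<le> minor_dim x3 (R - {i}) (insert j K\<^sub>0)"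
      using insert.IH[of "R - {i}" "insert j K\<^sub>0"] insert.prems by auto
    have "agree_off (insert p P) x3 N" "agree_off (insert p P) (x3(i := x3 i + unit_fun j)) N"
      using 3(1) p by (auto simp: agree_off_def unit_fun_def)
    then obtain x4 where 4: "agree_off (insert p P) x4 N"
      "minor_dim x3 (R - {i}) (insert j K\<^sub>0) \<le> minor_dim x4 R K\<^sub>0"
      using toggle_entry_rank[OF insert.prems(1,2) iR, of x3 j] by blast
    define x where "x = (if minor_dim x1 R K\<^sub>0 \<le> minor_dim x4 R K\<^sub>0 then x4 else x1)"
    have x: "agree_off (insert p P) x N" "minor_dim x1 R K\<^sub>0 \<le> minor_dim x R K\<^sub>0"
      "minor_dim x4 R K\<^sub>0 \<le> minor_dim x R K\<^sub>0"
      using a1 4 by (auto simp: x_def)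
    have fin: "finite I1" "finite I3"
      using 1 3 insert.prems by (auto intro: finite_subset)
    \<comment> \<open>Counted in \<open>R\<close>, the dropped row \<open>i\<close> is one further
      row outside \<open>I3\<close>; this is the only loss in the estimate below.\<close>
    have "card (R - I3) = Suc (card (R - {i} - I3))"
    proof -
      have "R - I3 = insert i (R - {i} - I3)"
        using iR 3 by auto
      then show ?thesis
        using insert.prems by simp
    qed
    moreover have "card (R - I1) + card (R - I3) = card (R - (I1 \<union> I3)) + card (R - (I1 \<inter> I3))"
      using card_Un_Int[of "R - I1" "R - I3"] insert.prems
      by (simp add: Diff_Int Diff_Un)
    \<comment> \<open>With \<open>r\<close> the rank attained by \<open>x\<close>, the costs of the
      two uncrossed pairs add up to at most \<open>2 * r + 1\<close>, so one of them is at most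
      \<open>r\<close>.\<close>
    ultimately have "minor_dim N (I1 \<union> I3) (K1 \<union> K3) + card (R - (I1 \<union> I3)) \<le> minor_dim x R K\<^sub>0 \<or>
        minor_dim N (I1 \<inter> I3) (K1 \<inter> K3) + card (R - (I1 \<inter> I3)) \<le> minor_dim x R K\<^sub>0"
      using minor_dim_uncross[OF fin(1) 1(4) fin(2) 3(4), of N] 1(6) 3(6) 4(2) x by linarith
    \<comment> \<open>Both pairs respect the entry \<open>p\<close> as well: the union because
      \<open>j \<in> K3\<close>, the intersection because \<open>i \<notin> I3\<close>.\<close>
    then show ?thesis
    proof
      assume "minor_dim N (I1 \<union> I3) (K1 \<union> K3) + card (R - (I1 \<union> I3)) \<le> minor_dim x R K\<^sub>0"
      then show ?thesis
        using 1 3 x p by (intro exI[of _ x] exI[of _ "I1 \<union> I3"] exI[of _ "K1 \<union> K3"]) auto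
    next
      assume "minor_dim N (I1 \<inter> I3) (K1 \<inter> K3) + card (R - (I1 \<inter> I3)) \<le> minor_dim x R K\<^sub>0"
      then show ?thesis
        using 1 3 x p by (intro exI[of _ x] exI[of _ "I1 \<inter> I3"] exI[of _ "K1 \<inter> K3"]) auto
    qed
  qed
qed

section \<open>Matrix rank as a dimension of functions\<close>

text \<open>The bridge from matrix rank to \<open>fun_vs.dim\<close>: placing column entries at the
  points \<open>\<sigma> i\<close>, scaling by \<open>a\<close> and extending by zero is an
  injective linear map \<open>H\<close>. The factor \<open>a\<close> accommodates the sign with
  which the cut matrix occurs inside I - F.\<close>

lemma mrank_eq_dim:
  fixes A :: "'a::field mat" and w :: "nat \<Rightarrow> 'c \<Rightarrow> 'a"
  assumes A: "A \<in> carrier_mat n k" and inj: "inj_on \<sigma> {..<n}" and a: "a \<noteq> 0"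
    and entry: "\<And>i j. i < n \<Longrightarrow> j < k \<Longrightarrow> w j (\<sigma> i) = a * A $$ (i, j)"
    and supp: "\<And>j c. j < k \<Longrightarrow> c \<notin> \<sigma> ` {..<n} \<Longrightarrow> w j c = 0"
  shows "mrank A = fun_vs.dim (w ` {..<k})"
proof -
  interpret V: vec_space "TYPE('a)" n .
  define H :: "'a vec \<Rightarrow> 'c \<Rightarrow> 'a" where
    "H v = (\<lambda>c. if c \<in> \<sigma> ` {..<n} then a * v $ the_inv_into {..<n} \<sigma> c else 0)" for v
  have H\<sigma>: "H v (\<sigma> i) = a * v $ i" if "i < n" for v i
    using that inj by (simp add: H_def the_inv_into_f_f)
  have H0: "H v c = 0" if "c \<notin> \<sigma> ` {..<n}" for v c
    using that by (simp add: H_def)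
  have C: "set (cols A) \<subseteq> carrier_vec n"
    using A cols_dim by blast
  have w: "w ` {..<k} = H ` set (cols A)"
  proof -
    have "w j = H (col A j)" if "j < k" for j
    proof
      fix c
      show "w j c = H (col A j) c"
        using that entry supp H\<sigma> H0 A by (cases "c \<in> \<sigma> ` {..<n}") auto
    qed
    then have "w ` {..<k} = (\<lambda>j. H (col A j)) ` {..<k}"
      by (intro image_cong) auto
    also have "\<dots> = H ` set (cols A)"
      using A by (auto simp: cols_def)
    finally show ?thesis .
  qed
  have lincomb: "H (V.lincomb u U) = (\<Sum>b\<in>U. (\<lambda>x. u b * H b x))" if "U \<subseteq> carrier_vec n" for u U
  proof
    fix c
    show "H (V.lincomb u U) c = (\<Sum>b\<in>U. (\<lambda>x. u b * H b x)) c"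
    proof (cases "c \<in> \<sigma> ` {..<n}")
      case True
      then obtain i where "i < n" "c = \<sigma> i" by auto
      then show ?thesis
        using that by (simp add: H\<sigma> fun_sum_apply V.lincomb_index sum_distrib_left mult.left_commute)
    qed (simp add: H0 fun_sum_apply)
  qed
  have Hinj: "v = v'" if "H v = H v'" "v \<in> carrier_vec n" "v' \<in> carrier_vec n" for v v'
  proof (rule eq_vecI)
    fix i assume "i < dim_vec v'"
    then have "a * v $ i = a * v' $ i"
      using that H\<sigma>[of i v] H\<sigma>[of i v'] by auto
    then show "v $ i = v' $ i" using a by simp
  qed (use that in auto)
  \<comment> \<open>The rank is the size of a maximal independent set of columns; maximality also
    makes its image span all the columns.\<close>
  have "\<exists>B. finite B \<and> maximal B (\<lambda>T. T \<subseteq> set (cols A) \<and> V.lin_indpt T) \<and> {} \<subseteq> B"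
    by (rule maximal_exists_superset[of "set (cols A)"]) (auto simp: V.lin_dep_def)
  then obtain B where fB: "finite B" and max: "maximal B (\<lambda>T. T \<subseteq> set (cols A) \<and> V.lin_indpt T)"
    by blast
  have B: "B \<subseteq> set (cols A)" "V.lin_indpt B"
    using max by (auto simp: maximal_def)
  have BC: "B \<subseteq> carrier_vec n"
    using B C by auto
  have HB: "inj_on H B"
    using Hinj BC by (intro inj_onI) (meson subsetD)
  have "fun_vs.independent (H ` B)"
  proof
    assume "fun_vs.dependent (H ` B)"
    then obtain u where u: "\<exists>v\<in>H ` B. u v \<noteq> 0" "(\<Sum>v\<in>H ` B. (\<lambda>x. u v * v x)) = 0"
      using fun_vs.dependent_finite[of "H ` B"] fB by auto
    have "H (V.lincomb (u \<circ> H) B) = 0"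
      using u(2) unfolding lincomb[OF BC] sum.reindex[OF HB] by (simp add: o_def)
    also have "\<dots> = H (0\<^sub>v n)"
    proof
      fix c
      show "0 c = H (0\<^sub>v n) c"
        by (cases "c \<in> \<sigma> ` {..<n}") (auto simp: H\<sigma> H0)
    qed
    finally have "V.lincomb (u \<circ> H) B = 0\<^sub>v n"
      using BC by (intro Hinj) auto
    moreover obtain b where "b \<in> B" "(u \<circ> H) b \<noteq> 0"
      using u(1) by auto
    ultimately have "V.lin_dep B"
      unfolding V.lin_dep_def using fB
      by (intro exI[of _ B] exI[of _ "u \<circ> H"] exI[of _ b]) (auto simp: class_ring_simps)
    then show False using B by simp
  qed
  moreover have "H v \<in> fun_vs.span (H ` B)" if v: "v \<in> set (cols A)" for v
  proof (cases "v \<in> B")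
    case False
    then have "V.lin_dep (B \<union> {v})"
      using max v B unfolding maximal_def by blast
    then have "v \<in> V.span B"
      using V.lin_dep_iff_in_span[of B v] BC B False v C by auto
    then obtain u where "v = V.lincomb u B"
      using V.finite_in_span[OF fB] BC by auto
    then have "H v = (\<Sum>b\<in>B. (\<lambda>x. u b * H b x))"
      using lincomb BC by simp
    moreover have "\<dots> \<in> fun_vs.span (H ` B)"
      by (intro fun_vs.span_sum fun_vs.span_scale fun_vs.span_base) auto
    ultimately show ?thesis by simp
  qed (auto intro: fun_vs.span_base)
  ultimately have "card (H ` B) = fun_vs.dim (H ` set (cols A))"
    using B by (intro fun_vs.basis_card_eq_dim) auto
  moreover have "mrank A = card B"
    unfolding mrank_def using V.rank_card_indpt[OF A max] A by auto
  ultimately show ?thesis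
    using w card_image[OF HB] by simp
qed

lemma mult_mat_entry:
  assumes "A \<in> carrier_mat a m" "B \<in> carrier_mat m b" "i < a" "k < b"
  shows "(A * B) $$ (i, k) = (\<Sum>j<m. A $$ (i, j) * B $$ (j, k))"
  using assms by (auto simp: scalar_prod_def lessThan_atLeast0 intro!: sum.cong)

section \<open>The block matrix of an ADT network\<close>

locale adt =
  fixes V :: "'v set" and m mu nu :: nat and node :: "nat \<Rightarrow> 'v" and is_in :: "nat \<Rightarrow> bool"
    and E :: "(nat \<times> nat) set" and S T :: 'v
  assumes network: "adt_network V m node is_in E"
    and source: "S \<in> V" and sink: "T \<in> V" and distinct: "S \<noteq> T"
begin

lemma edgeD:
  assumes "(i, j) \<in> E"
  shows "i < m" "j < m" "\<not> is_in i" "is_in j" "node i \<noteq> node j"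
  using network assms by (auto simp: adt_network_def)

lemma node_V: "i < m \<Longrightarrow> node i \<in> V"
  using network by (auto simp: adt_network_def)

text \<open>Block matrix with blocks I - F, B^T (rows Inl) and -A, 0 (rows Inr); Inl columns belong to
  ports, Inr columns to the outputs of T.\<close>
fun column :: "(nat \<Rightarrow> nat \<Rightarrow> 'a::field) \<Rightarrow> (nat \<Rightarrow> nat \<Rightarrow> 'a) \<Rightarrow> (nat \<Rightarrow> nat \<Rightarrow> 'a) \<Rightarrow> nat + nat \<Rightarrow> nat + nat \<Rightarrow> 'a" where
  "column \<alpha> \<beta> \<epsilon> (Inl j) (Inl i) = (if i < m \<and> j < m then (if i = j then 1 else 0) -
     (if (i, j) \<in> E then 1 else if is_in i \<and> \<not> is_in j \<and> node i = node j then \<beta> i j else 0) else 0)"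
| "column \<alpha> \<beta> \<epsilon> (Inl j) (Inr s) = (if s < mu \<and> j < m \<and> \<not> is_in j \<and> node j = S then - \<alpha> s j else 0)"
| "column \<alpha> \<beta> \<epsilon> (Inr k) (Inl i) = (if k < nu \<and> i < m \<and> is_in i \<and> node i = T then \<epsilon> i k else 0)"
| "column \<alpha> \<beta> \<epsilon> (Inr k) (Inr s) = 0"

text \<open>Each pair lists the column first and the row second: the columns of the block matrix
  play the part of the rows in \<open>max_rank_completion\<close>, so there \<open>I\<close> selects
  columns and \<open>K\<close> discards rows.\<close>

definition free_entries :: "((nat + nat) \<times> (nat + nat)) set" where
  "free_entries = {(Inl j, Inl i) | i j. i < m \<and> j < m \<and> is_in i \<and> \<not> is_in j \<and> node i = node j}
     \<union> {(Inl j, Inr s) | j s. s < mu \<and> j < m \<and> \<not> is_in j \<and> node j = S}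
     \<union> {(Inr k, Inl i) | k i. k < nu \<and> i < m \<and> is_in i \<and> node i = T}"

lemma mem_free_entries [simp]:
  "(Inl j, Inl i) \<in> free_entries \<longleftrightarrow> i < m \<and> j < m \<and> is_in i \<and> \<not> is_in j \<and> node i = node j"
  "(Inl j, Inr s) \<in> free_entries \<longleftrightarrow> s < mu \<and> j < m \<and> \<not> is_in j \<and> node j = S"
  "(Inr k, Inl i) \<in> free_entries \<longleftrightarrow> k < nu \<and> i < m \<and> is_in i \<and> node i = T"
  "(Inr k, Inr s) \<notin> free_entries"
  by (auto simp: free_entries_def)

abbreviation indices :: "(nat + nat) set" where
  "indices \<equiv> Inl ` {..<m} \<union> Inr ` {..<nu}"

section \<open>Completions of the block matrix and coding coefficients\<close>

lemma finite_free_entries: "finite free_entries"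
proof (rule finite_subset)
  show "free_entries \<subseteq> (Inl ` {..<m} \<union> Inr ` {..<nu}) \<times> (Inl ` {..<m} \<union> Inr ` {..<mu})"
    by (auto simp: free_entries_def)
qed auto

lemma agree_off_column:
  "agree_off free_entries (column \<alpha> \<beta> \<epsilon>) (column (\<lambda>_ _. 0) (\<lambda>_ _. 0) (\<lambda>_ _. 0))"
proof -
  have "column \<alpha> \<beta> \<epsilon> i k = column (\<lambda>_ _. 0) (\<lambda>_ _. 0) (\<lambda>_ _. 0) i k" if "(i, k) \<notin> free_entries" for i k
    using that by (cases i; cases k) auto
  then show ?thesis
    by (simp add: agree_off_def)
qed

text \<open>Every free entry is one coefficient, with a minus sign for \<alpha> and \<beta>. A
  \<beta> position is neither diagonal nor an edge, because it leads from an input to an output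
  port, so nothing else contributes to it.\<close>

lemma completion_is_column:
  assumes "agree_off free_entries x (column (\<lambda>_ _. 0) (\<lambda>_ _. 0) (\<lambda>_ _. 0))"
  obtains \<alpha> \<beta> \<epsilon> where "x = column \<alpha> \<beta> \<epsilon>"
proof
  let ?\<alpha> = "\<lambda>s j. - x (Inl j) (Inr s)" and ?\<beta> = "\<lambda>i j. - x (Inl j) (Inl i)" and ?\<epsilon> = "\<lambda>i k. x (Inr k) (Inl i)"
  let ?c = "column ?\<alpha> ?\<beta> ?\<epsilon>"
  have "x i k = ?c i k" for i k
  proof (cases "(i, k) \<in> free_entries")
    case True
    show ?thesis
      using True
    proof (cases i; cases k)
      fix j l assume "i = Inl j" "k = Inl l"
      moreover from this True have "(l, j) \<notin> E" "l \<noteq> j"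
        using edgeD(3)[of l j] by auto
      ultimately show ?thesis
        using True by simp
    qed simp_all
  next
    case False
    then have "x i k = column (\<lambda>_ _. 0) (\<lambda>_ _. 0) (\<lambda>_ _. 0) i k"
      using assms by (auto simp: agree_off_def)
    also have "\<dots> = ?c i k"
      using False agree_off_column[of ?\<alpha> ?\<beta> ?\<epsilon>] unfolding agree_off_def by simp
    finally show ?thesis .
  qed
  then show "x = ?c" by blast
qed

text \<open>Ordered along the flow of the network, F is strictly triangular, so a kernel vector of I
  - F vanishes port by port. Hence \<open>the (mat_inverse ...)\<close> in
  \<open>system_matrix\<close> is a genuine inverse.\<close>

lemma F_inverse:
  obtains K where "mat_inverse (1\<^sub>m m - F_mat m node is_in E \<beta>) = Some K"
    "K \<in> carrier_mat m m" "(1\<^sub>m m - F_mat m node is_in E \<beta>) * K = 1\<^sub>m m"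
    "K * (1\<^sub>m m - F_mat m node is_in E \<beta>) = 1\<^sub>m m"
proof -
  let ?F = "F_mat m node is_in E \<beta>"
  let ?D = "{(node i, node j) | i j. (i, j) \<in> E}"
  have c: "1\<^sub>m m - ?F \<in> carrier_mat m m"
    by (auto simp: F_mat_def)
  have "finite ?D"
  proof (rule finite_subset)
    show "?D \<subseteq> (node ` {..<m}) \<times> (node ` {..<m})"
      by (auto dest: edgeD)
  qed auto
  moreover have "acyclic ?D"
    using network by (simp add: adt_network_def)
  ultimately have "wf (?D\<inverse>)"
    by (rule finite_acyclic_wf_converse)
  \<comment> \<open>Downstream ports are smaller: an edge descends in the supernode component, and
    the flag puts the output ports of a supernode below its input ports.\<close>
  define W where "W = inv_image (?D\<inverse> <*lex*> less_than) (\<lambda>i. (node i, if is_in i then 1 else 0 :: nat))"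
  have wfW: "wf W"
    unfolding W_def using \<open>wf (?D\<inverse>)\<close> by (intro wf_inv_image wf_lex_prod wf_less_than)
  have W: "(j, i) \<in> W" if "i < m" "j < m" "?F $$ (i, j) \<noteq> 0" for i j
    using that by (auto simp: F_mat_def W_def split: if_splits)
  have "det (1\<^sub>m m - ?F) \<noteq> 0"
  proof
    assume "det (1\<^sub>m m - ?F) = 0"
    then obtain v where v: "v \<in> carrier_vec m" "v \<noteq> 0\<^sub>v m" "(1\<^sub>m m - ?F) *\<^sub>v v = 0\<^sub>v m"
      using det_0_iff_vec_prod_zero_field[OF c] by blast
    have "i < m \<longrightarrow> v $ i = 0" for i
    proof (induction i rule: wf_induct_rule[OF wfW])
      case (1 i)
      show ?case
      proof
        assume i: "i < m"
        have "((1\<^sub>m m - ?F) *\<^sub>v v) $ i = 0"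
          using v(3) i by simp
        moreover have "((1\<^sub>m m - ?F) *\<^sub>v v) $ i = (\<Sum>j<m. ((if i = j then 1 else 0) - ?F $$ (i, j)) * v $ j)"
          using i v(1) c by (auto simp: scalar_prod_def F_mat_def lessThan_atLeast0 intro!: sum.cong)
        \<comment> \<open>A nonzero entry of F in row \<open>i\<close> leads to a smaller port,
          where \<open>v\<close> is already known to vanish.\<close>
        moreover have "\<dots> = (\<Sum>j<m. (if i = j then v $ i else 0))"
        proof (rule sum.cong)
          fix j assume "j \<in> {..<m}"
          then show "((if i = j then 1 else 0) - ?F $$ (i, j)) * v $ j = (if i = j then v $ i else 0)"
            using 1[of j] W[OF i, of j] by (cases "?F $$ (i, j) = 0") auto
        qed simp
        ultimately show "v $ i = 0"
          using i by simp
      qed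
    qed
    then have "v = 0\<^sub>v m"
      using v(1) by (intro eq_vecI) auto
    then show False using v by simp
  qed
  then have "mat_inverse (1\<^sub>m m - ?F) \<noteq> None"
    using mat_inverse(1)[OF c, of undefined] det_non_zero_imp_unit[OF c, of undefined] by auto
  then show ?thesis
    using mat_inverse(2)[OF c] that by blast
qed

section \<open>Rank of the full block matrix\<close>

lemma column_carrier: "F_mat m node is_in E \<beta> \<in> carrier_mat m m"
  "A_mat mu m node is_in S \<alpha> \<in> carrier_mat mu m" "B_mat nu m node is_in T \<epsilon> \<in> carrier_mat nu m"
  by (auto simp: F_mat_def A_mat_def B_mat_def)

lemma column_entries:
  "i < m \<Longrightarrow> j < m \<Longrightarrow> column \<alpha> \<beta> \<epsilon> (Inl j) (Inl i) = (1\<^sub>m m - F_mat m node is_in E \<beta>) $$ (i, j)"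
  "s < mu \<Longrightarrow> j < m \<Longrightarrow> column \<alpha> \<beta> \<epsilon> (Inl j) (Inr s) = - A_mat mu m node is_in S \<alpha> $$ (s, j)"
  "i < m \<Longrightarrow> k < nu \<Longrightarrow> column \<alpha> \<beta> \<epsilon> (Inr k) (Inl i) = transpose_mat (B_mat nu m node is_in T \<epsilon>) $$ (i, k)"
  by (auto simp: F_mat_def A_mat_def B_mat_def)

text \<open>Row \<open>j\<close> of the inverse of I - F is a functional on the \<open>Inl\<close>
  coordinates that is dual to the port columns; \<open>U\<close> is its kernel. This feeds
  \<open>dim_image_Un_dual\<close>.\<close>

lemma dual_of_ports:
  fixes j :: nat
  assumes "j < m"
  obtains U where "fun_vs.subspace U" "column \<alpha> \<beta> \<epsilon> (Inl j) \<notin> U"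
    "\<And>l. l < m \<Longrightarrow> l \<noteq> j \<Longrightarrow> column \<alpha> \<beta> \<epsilon> (Inl l) \<in> U"
    "\<And>f. (\<And>i. f (Inl i) = 0) \<Longrightarrow> f \<in> U"
proof -
  let ?N = "1\<^sub>m m - F_mat m node is_in E \<beta>"
  obtain K where K: "K \<in> carrier_mat m m" "K * ?N = 1\<^sub>m m"
    using F_inverse[of \<beta>] by blast
  define \<phi> where "\<phi> f = (\<Sum>i<m. K $$ (j, i) * f (Inl i))" for f :: "nat + nat \<Rightarrow> 'a"
  have \<phi>: "\<phi> (column \<alpha> \<beta> \<epsilon> (Inl l)) = (if j = l then 1 else 0)" if l: "l < m" for l
  proof -
    have "\<phi> (column \<alpha> \<beta> \<epsilon> (Inl l)) = (\<Sum>i<m. K $$ (j, i) * ?N $$ (i, l))"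
      unfolding \<phi>_def using l by (intro sum.cong refl) (simp only: lessThan_iff column_entries(1))
    also have "\<dots> = (K * ?N) $$ (j, l)"
      by (intro mult_mat_entry[OF K(1) _ assms l, symmetric] minus_carrier_mat column_carrier)
    finally show ?thesis
      using K assms l by simp
  qed
  show ?thesis
  proof
    show "fun_vs.subspace {f. \<phi> f = 0}"
    proof (rule fun_vs.subspaceI)
      fix c :: 'a and x assume "x \<in> {f. \<phi> f = 0}"
      moreover have "\<phi> (\<lambda>i. c * x i) = c * \<phi> x"
        by (simp add: \<phi>_def sum_distrib_left mult.left_commute)
      ultimately show "(\<lambda>i. c * x i) \<in> {f. \<phi> f = 0}" by simp
    qed (auto simp: \<phi>_def distrib_left sum.distrib)
  qed (use \<phi> assms in \<open>auto simp: \<phi>_def\<close>)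
qed

text \<open>Schur complement: eliminating the port coordinates from the output columns leaves
  exactly the columns of M, and the port columns contribute \<open>m\<close> by duality.\<close>

lemma minor_dim_columns:
  "minor_dim (column \<alpha> \<beta> \<epsilon>) indices {} = m + mrank (system_matrix mu nu m node is_in E S T \<alpha> \<beta> \<epsilon>)"
proof -
  let ?N = "1\<^sub>m m - F_mat m node is_in E \<beta>" and ?A = "A_mat mu m node is_in S \<alpha>"
    and ?B = "transpose_mat (B_mat nu m node is_in T \<epsilon>)"
    and ?M = "system_matrix mu nu m node is_in E S T \<alpha> \<beta> \<epsilon>"
  let ?x = "column \<alpha> \<beta> \<epsilon>"
  obtain K where inv: "mat_inverse ?N = Some K" and K: "K \<in> carrier_mat m m" "?N * K = 1\<^sub>m m"
    using F_inverse[of \<beta>] by blast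
  have cN: "?N \<in> carrier_mat m m" and cA: "?A \<in> carrier_mat mu m" and cB: "?B \<in> carrier_mat m nu"
    by (intro minus_carrier_mat column_carrier transpose_carrier_mat[THEN iffD2])+
  \<comment> \<open>Column \<open>k\<close> of \<open>Y\<close> holds the multiples of the port
    columns to subtract from output column \<open>k\<close>; the remainder is \<open>c k\<close>
    below.\<close>
  define Y where "Y = K * ?B"
  have Y: "Y \<in> carrier_mat m nu" "?N * Y = ?B" "?A * Y = ?M"
  proof -
    show "Y \<in> carrier_mat m nu"
      unfolding Y_def using K(1) cB by (rule mult_carrier_mat)
    have "?N * Y = (?N * K) * ?B"
      unfolding Y_def by (rule assoc_mult_mat[OF cN K(1) cB, symmetric])
    then show "?N * Y = ?B"
      unfolding K(2) using left_mult_one_mat[OF cB] by simp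
    show "?A * Y = ?M"
      unfolding Y_def system_matrix_def inv option.sel by (rule assoc_mult_mat[OF cA K(1) cB, symmetric])
  qed
  have cM: "?M \<in> carrier_mat mu nu"
    unfolding Y(3)[symmetric] using cA Y(1) by (rule mult_carrier_mat)
  define c :: "nat \<Rightarrow> nat + nat \<Rightarrow> 'a" where
    "c k = (\<lambda>x. case x of Inl _ \<Rightarrow> 0 | Inr s \<Rightarrow> if s < mu then ?M $$ (s, k) else 0)" for k
  have "?x (Inr k) - c k \<in> fun_vs.span (?x ` Inl ` {..<m})" if k: "k < nu" for k
  proof -
    have "?x (Inr k) - c k = (\<Sum>j<m. (\<lambda>x. Y $$ (j, k) * ?x (Inl j) x))"
    proof
      fix x
      show "(?x (Inr k) - c k) x = (\<Sum>j<m. (\<lambda>x. Y $$ (j, k) * ?x (Inl j) x)) x"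
      proof (cases x)
        case (Inl i)
        show ?thesis
        proof (cases "i < m")
          case True
          have "(\<Sum>j<m. Y $$ (j, k) * ?x (Inl j) (Inl i)) = (\<Sum>j<m. ?N $$ (i, j) * Y $$ (j, k))"
            using True by (intro sum.cong refl) (simp only: lessThan_iff column_entries(1) mult.commute)
          also have "\<dots> = (?N * Y) $$ (i, k)"
            using mult_mat_entry[OF cN Y(1) True k] by simp
          also have "\<dots> = ?x (Inr k) (Inl i)"
            unfolding Y(2) using True k by (simp only: column_entries(3))
          finally show ?thesis
            using Inl by (simp add: fun_sum_apply c_def)
        qed (simp add: Inl fun_sum_apply c_def)
      next
        case (Inr s)
        show ?thesis
        proof (cases "s < mu")
          case True
          have "(\<Sum>j<m. Y $$ (j, k) * ?x (Inl j) (Inr s)) = (\<Sum>j<m. - (?A $$ (s, j) * Y $$ (j, k)))"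
            using True by (intro sum.cong refl) (simp only: lessThan_iff column_entries(2) mult.commute mult_minus_left mult_minus_right)
          also have "\<dots> = - (?A * Y) $$ (s, k)"
            using mult_mat_entry[OF cA Y(1) True k] by (simp add: sum_negf)
          finally show ?thesis
            using Inr True Y(3) by (simp add: fun_sum_apply c_def)
        qed (simp add: Inr fun_sum_apply c_def)
      qed
    qed
    also have "\<dots> \<in> fun_vs.span (?x ` Inl ` {..<m})"
      by (intro fun_vs.span_sum fun_vs.span_scale fun_vs.span_base) auto
    finally show ?thesis .
  qed
  then have "minor_dim ?x indices {} = fun_vs.dim (?x ` Inl ` {..<m} \<union> c ` {..<nu})"
    unfolding minor_dim_def
    using fun_vs.dim_Un_replace[of "{..<nu}" "\<lambda>k. ?x (Inr k)" c "?x ` Inl ` {..<m}"]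
    by (simp add: image_Un image_image)
  also have "\<dots> = card {..<m} + fun_vs.dim (c ` {..<nu})"
    unfolding image_image
  proof (rule fun_vs.dim_image_Un_dual)
    fix j assume "j \<in> {..<m}"
    then have j: "j < m" by simp
    obtain U where "fun_vs.subspace U" "?x (Inl j) \<notin> U"
      "\<And>l. l < m \<Longrightarrow> l \<noteq> j \<Longrightarrow> ?x (Inl l) \<in> U" "\<And>f. (\<And>i. f (Inl i) = 0) \<Longrightarrow> f \<in> U"
      using dual_of_ports[OF j, of \<alpha> \<beta> \<epsilon>] by blast
    then show "\<exists>U. fun_vs.subspace U \<and> ?x (Inl j) \<notin> U \<and> (\<lambda>j. ?x (Inl j)) ` ({..<m} - {j}) \<subseteq> U \<and> c ` {..<nu} \<subseteq> U"
      by (intro exI[of _ U]) (auto simp: c_def)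
  qed auto
  also have "fun_vs.dim (c ` {..<nu}) = mrank ?M"
  proof (rule mrank_eq_dim[symmetric, OF cM])
    show "inj_on Inr {..<mu}" by simp
    show "c j x = 0" if "x \<notin> Inr ` {..<mu}" for j x
      using that by (auto simp: c_def split: sum.split)
  qed (auto simp: c_def)
  finally show ?thesis by simp
qed

text \<open>The functionals dual to the port columns vanish on the unit vectors of source
  coordinates, so the two families are jointly independent.\<close>

lemma minor_dim_ports:
  assumes "J \<subseteq> {..<m}" "finite D"
  shows "minor_dim (column \<alpha> \<beta> \<epsilon>) (Inl ` J) (Inr ` D) = card J + card D"
proof -
  let ?x = "column \<alpha> \<beta> \<epsilon>"
  have fJ: "finite J" using assms finite_subset by blast
  have "minor_dim ?x (Inl ` J) (Inr ` D) = card J + fun_vs.dim (unit_fun ` Inr ` D :: (nat + nat \<Rightarrow> 'a) set)"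
    unfolding minor_dim_def image_image[of ?x]
  proof (rule fun_vs.dim_image_Un_dual)
    fix j assume "j \<in> J"
    then have j: "j < m" using assms by auto
    obtain U where "fun_vs.subspace U" "?x (Inl j) \<notin> U"
      "\<And>l. l < m \<Longrightarrow> l \<noteq> j \<Longrightarrow> ?x (Inl l) \<in> U" "\<And>f. (\<And>i. f (Inl i) = 0) \<Longrightarrow> f \<in> U"
      using dual_of_ports[OF j, of \<alpha> \<beta> \<epsilon>] by blast
    then show "\<exists>U. fun_vs.subspace U \<and> ?x (Inl j) \<notin> U \<and> (\<lambda>j. ?x (Inl j)) ` (J - {j}) \<subseteq> U \<and> unit_fun ` Inr ` D \<subseteq> U"
      using assms by (intro exI[of _ U]) (auto simp: unit_fun_def)
  qed (use assms fJ in auto)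
  moreover have "fun_vs.dim (unit_fun ` Inr ` D :: (nat + nat \<Rightarrow> 'a) set) = card D"
    using dim_Un_units[of "{}" "Inr ` D :: (nat + nat) set"] assms(2)
    by (simp add: card_image fun_vs.dim_eq_card_independent fun_vs.independent_empty)
  ultimately show ?thesis by simp
qed

section \<open>Pairs of index sets arising from cuts\<close>

definition cut_cols :: "'v set \<Rightarrow> (nat + nat) set" where
  "cut_cols \<Omega> = Inl ` {j. j < m \<and> (is_in j \<or> node j \<notin> \<Omega>)} \<union> Inr ` {..<nu}"

text \<open>In the pair of a cut, \<open>cut_cols\<close> keeps all columns except the output ports
  in \<Omega>, whereas \<open>cut_rows\<close> lists the rows to discard, in the role of
  \<open>K\<close>.\<close>

definition cut_rows :: "'v set \<Rightarrow> (nat + nat) set" where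
  "cut_rows \<Omega> = Inl ` {i. i < m \<and> is_in i \<and> node i \<notin> \<Omega>}"

lemma finite_cut: "finite (cut_cols \<Omega>)" "finite (cut_rows \<Omega>)" "cut_cols \<Omega> \<subseteq> indices"
  by (auto simp: cut_cols_def cut_rows_def)

lemma card_cut_cols: "card (indices - cut_cols \<Omega>) = card {j. j < m \<and> \<not> is_in j \<and> node j \<in> \<Omega>}"
proof -
  have "indices - cut_cols \<Omega> = Inl ` {j. j < m \<and> \<not> is_in j \<and> node j \<in> \<Omega>}"
    by (auto simp: cut_cols_def)
  then show ?thesis
    by (simp add: card_image)
qed

text \<open>The ports split into four classes by direction and side of the cut. Input ports outside
  \<Omega>, output ports outside \<Omega> and input ports inside \<Omega> each add their number to
  the dimension, the output ports inside \<Omega> are counted as missing columns, and what survives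
  is the cut matrix.\<close>

lemma minor_dim_cut:
  fixes \<alpha> \<beta> \<epsilon> :: "nat \<Rightarrow> nat \<Rightarrow> 'a::field"
  assumes "S \<in> \<Omega>" "T \<notin> \<Omega>"
  shows "minor_dim (column \<alpha> \<beta> \<epsilon>) (cut_cols \<Omega>) (cut_rows \<Omega>) + card (indices - cut_cols \<Omega>)
    = m + mrank (G_cut V m node is_in E \<Omega> :: 'a mat)"
proof -
  let ?x = "column (\<lambda>_ _. 0) (\<lambda>_ _. 0) (\<lambda>_ _. 0) :: nat + nat \<Rightarrow> nat + nat \<Rightarrow> 'a"
  define inS inT outS outT where
    "inS = {i. i < m \<and> is_in i \<and> node i \<in> \<Omega>}" and "inT = {i. i < m \<and> is_in i \<and> node i \<notin> \<Omega>}" and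
    "outS = {i. i < m \<and> \<not> is_in i \<and> node i \<in> \<Omega>}" and "outT = {i. i < m \<and> \<not> is_in i \<and> node i \<notin> \<Omega>}"
  note defs = inS_def inT_def outS_def outT_def
  have fin: "finite inS" "finite inT" "finite outS" "finite outT"
    by (auto simp: defs)
  \<comment> \<open>Coordinates to delete: \<open>inT\<close> is adjoined through
    \<open>cut_rows\<close>, and the columns of \<open>outT\<close> are themselves unit vectors once
    the coefficients are zero.\<close>
  define L where "L = (Inl ` (outT \<union> inT) :: (nat + nat) set)"
  define g where "g j = vanish L (?x (Inl j))" for j
  have cL: "card L = card outT + card inT"
    unfolding L_def by (subst card_image, simp) (intro card_Un_disjoint, auto simp: defs)
  have "{..<m} = (inS \<union> inT) \<union> (outS \<union> outT)"
    by (auto simp: defs)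
  then have "m = card ((inS \<union> inT) \<union> (outS \<union> outT))"
    by (metis card_lessThan)
  also have "\<dots> = card (inS \<union> inT) + card (outS \<union> outT)"
    using fin by (intro card_Un_disjoint) (auto simp: defs)
  also have "card (inS \<union> inT) = card inS + card inT"
    using fin by (intro card_Un_disjoint) (auto simp: defs)
  also have "card (outS \<union> outT) = card outS + card outT"
    using fin by (intro card_Un_disjoint) (auto simp: defs)
  finally have cm: "m = card inS + card inT + (card outS + card outT)" .
  have "minor_dim (column \<alpha> \<beta> \<epsilon>) (cut_cols \<Omega>) (cut_rows \<Omega>) = minor_dim ?x (cut_cols \<Omega>) (cut_rows \<Omega>)"
  proof (rule minor_dim_cong)
    fix i k assume "i \<in> cut_cols \<Omega>" "k \<notin> cut_rows \<Omega>"
    \<comment> \<open>A kept \<beta> entry would put its supernode on both sides of the cut;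
      \<alpha> entries need an output column of \<open>S \<in> \<Omega>\<close>, and \<epsilon>
      entries need an input row of \<open>T \<notin> \<Omega>\<close>.\<close>
    then have "(i, k) \<notin> free_entries"
      using assms by (auto simp: free_entries_def cut_cols_def cut_rows_def)
    then show "column \<alpha> \<beta> \<epsilon> i k = ?x i k"
      using agree_off_column[of \<alpha> \<beta> \<epsilon>] unfolding agree_off_def by blast
  qed (auto simp: finite_cut)
  also have "\<dots> = fun_vs.dim ((?x ` Inl ` (inS \<union> inT) \<union> ?x ` Inr ` {..<nu}) \<union> unit_fun ` L)"
  proof -
    have "?x (Inl j) = unit_fun (Inl j)" if "j \<in> outT" for j
    proof
      fix y
      show "?x (Inl j) y = unit_fun (Inl j) y"
        using that by (cases y) (auto simp: unit_fun_def defs dest: edgeD)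
    qed
    then have "?x ` Inl ` outT = unit_fun ` Inl ` outT"
      unfolding image_image by (intro image_cong) auto
    moreover have "cut_cols \<Omega> = Inl ` (inS \<union> inT) \<union> Inl ` outT \<union> Inr ` {..<nu}"
      by (auto simp: cut_cols_def defs)
    moreover have "cut_rows \<Omega> = Inl ` inT"
      by (auto simp: cut_rows_def defs)
    ultimately show ?thesis
      unfolding minor_dim_def L_def by (simp only: image_Un) (simp only: ac_simps Un_ac)
  qed
  also have "\<dots> = card L + fun_vs.dim (vanish L ` (?x ` Inl ` (inS \<union> inT) \<union> ?x ` Inr ` {..<nu}))"
    using fin by (intro dim_Un_units) (auto simp: L_def)
  also have "vanish L ` (?x ` Inl ` (inS \<union> inT) \<union> ?x ` Inr ` {..<nu}) = g ` inS \<union> (g ` inT \<union> vanish L ` ?x ` Inr ` {..<nu})"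
    unfolding image_Un image_image g_def by (simp only: Un_assoc)
  \<comment> \<open>Edges start at output ports, so among these columns only that of
    \<open>j\<close> is nonzero at the input coordinate \<open>j\<close>; evaluation there is the
    dual functional.\<close>
  also have "fun_vs.dim \<dots> = card inS + fun_vs.dim (g ` inT \<union> vanish L ` ?x ` Inr ` {..<nu})"
  proof (rule fun_vs.dim_image_Un_dual)
    fix j assume j: "j \<in> inS"
    show "\<exists>U. fun_vs.subspace U \<and> g j \<notin> U \<and> g ` (inS - {j}) \<subseteq> U \<and> g ` inT \<union> vanish L ` ?x ` Inr ` {..<nu} \<subseteq> U"
      using j by (intro exI[of _ "{f. f (Inl j) = 0}"] conjI subspace_vanish_at)
        (auto simp: g_def L_def defs dest: edgeD)
  qed (use fin in auto)
  also have "fun_vs.dim (g ` inT \<union> vanish L ` ?x ` Inr ` {..<nu}) = fun_vs.dim (g ` inT)"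
  proof (rule antisym)
    have "vanish L (?x (Inr k)) = 0" for k
    proof
      fix y show "vanish L (?x (Inr k)) y = 0 y" by (cases y) auto
    qed
    then show "fun_vs.dim (g ` inT \<union> vanish L ` ?x ` Inr ` {..<nu}) \<le> fun_vs.dim (g ` inT)"
      using fin by (intro fun_vs.dim_mono_finite) (auto intro: fun_vs.span_base simp: fun_vs.span_zero)
    show "fun_vs.dim (g ` inT) \<le> fun_vs.dim (g ` inT \<union> vanish L ` ?x ` Inr ` {..<nu})"
      using fin by (intro fun_vs.dim_mono_finite) (auto intro: fun_vs.span_base)
  qed
  \<comment> \<open>With \<open>L\<close> deleted, the column of an input port outside \<Omega>
    retains only its edges from output ports in \<Omega>, each with entry -1.\<close>
  also have "fun_vs.dim (g ` inT) = mrank (G_cut V m node is_in E \<Omega> :: 'a mat)"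
  proof -
    define rs cs where "rs = sorted_list_of_set outS" and "cs = sorted_list_of_set inT"
    have rs: "set rs = outS" "distinct rs" and cs: "set cs = inT"
      using fin by (auto simp: rs_def cs_def)
    have "inT = {j. j < m \<and> is_in j \<and> node j \<in> V - \<Omega>}"
      using node_V by (auto simp: inT_def)
    then have G: "(G_cut V m node is_in E \<Omega> :: 'a mat) =
        mat (length rs) (length cs) (\<lambda>(a, b). if (rs ! a, cs ! b) \<in> E then 1 else 0)"
      unfolding G_cut_def rs_def cs_def outS_def by (simp add: Let_def)
    have "g ` inT = (\<lambda>b. g (cs ! b)) ` {..<length cs}"
      unfolding cs[symmetric] by (auto simp: set_conv_nth)
    moreover have "mrank (G_cut V m node is_in E \<Omega> :: 'a mat) = fun_vs.dim ((\<lambda>b. g (cs ! b)) ` {..<length cs})"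
    proof (rule mrank_eq_dim)
      show "(G_cut V m node is_in E \<Omega> :: 'a mat) \<in> carrier_mat (length rs) (length cs)"
        by (simp add: G)
      show "inj_on (\<lambda>a. Inl (rs ! a)) {..<length rs}"
        using rs(2) by (auto simp: inj_on_def nth_eq_iff_index_eq)
      show "(-1 :: 'a) \<noteq> 0" by simp
      fix b assume b: "b < length cs"
      then have csb: "cs ! b \<in> inT" using cs nth_mem by blast
      show "g (cs ! b) (Inl (rs ! a)) = -1 * G_cut V m node is_in E \<Omega> $$ (a, b)" if a: "a < length rs" for a
      proof -
        have "rs ! a \<in> outS" using rs a nth_mem by blast
        then show ?thesis
          using csb a b by (auto simp: G g_def L_def defs)
      qed
      show "g (cs ! b) y = 0" if "y \<notin> (\<lambda>a. Inl (rs ! a)) ` {..<length rs}" for y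
      proof (cases y)
        case (Inl i)
        have "i \<notin> outS"
        proof
          assume "i \<in> outS"
          then obtain a where "a < length rs" "i = rs ! a"
            using rs by (metis in_set_conv_nth)
          then show False using that Inl by auto
        qed
        then show ?thesis
          using csb Inl by (auto simp: g_def L_def defs dest: edgeD)
      next
        case (Inr s)
        then show ?thesis
          using csb by (auto simp: g_def L_def defs)
      qed
    qed
    ultimately show ?thesis by simp
  qed
  finally show ?thesis
    using cm cL card_cut_cols[of \<Omega>] unfolding outS_def by linarith
qed

section \<open>The two inequalities between coding rank and cut rank\<close>

lemma system_rank_le_cut:
  fixes \<alpha> \<beta> \<epsilon> :: "nat \<Rightarrow> nat \<Rightarrow> 'a::field"
  assumes "S \<in> \<Omega>" "T \<notin> \<Omega>"
  shows "mrank (system_matrix mu nu m node is_in E S T \<alpha> \<beta> \<epsilon>) \<le> mrank (G_cut V m node is_in E \<Omega> :: 'a mat)"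
proof -
  let ?x = "column \<alpha> \<beta> \<epsilon>"
  \<comment> \<open>Restoring a missing column raises the rank by at most one, and adjoining unit
    vectors never lowers it; the summand \<open>m\<close> cancels at the end.\<close>
  have "minor_dim ?x indices {} \<le> minor_dim ?x (cut_cols \<Omega>) {} + card (indices - cut_cols \<Omega>)"
    by (intro minor_dim_extend finite_cut) auto
  also have "minor_dim ?x (cut_cols \<Omega>) {} \<le> minor_dim ?x (cut_cols \<Omega>) (cut_rows \<Omega>)"
    by (intro minor_dim_mono finite_cut) auto
  finally show ?thesis
    using minor_dim_cut[OF assms, of \<alpha> \<beta> \<epsilon>] minor_dim_columns[of \<alpha> \<beta> \<epsilon>] by simp
qed

text \<open>With no destination output in \<open>I\<close> a pair costs at least
  \<open>m + nu\<close>; with all source coordinates in \<open>K\<close> at least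
  \<open>m + mu\<close>. Otherwise the absence of free entries from the minor forces a cut whose
  pair costs no more.\<close>

lemma minor_ge_cut:
  fixes N :: "nat + nat \<Rightarrow> nat + nat \<Rightarrow> 'a::field"
  defines "N \<equiv> column (\<lambda>_ _. 0) (\<lambda>_ _. 0) (\<lambda>_ _. 0)"
  assumes I: "I \<subseteq> indices" and K: "finite K" and free: "\<forall>(i, k) \<in> free_entries. i \<in> I \<longrightarrow> k \<in> K"
    and c_mu: "c \<le> mu" and c_nu: "c \<le> nu"
    and c_cut: "\<And>\<Omega>. \<Omega> \<subseteq> V \<Longrightarrow> S \<in> \<Omega> \<Longrightarrow> T \<notin> \<Omega> \<Longrightarrow> c \<le> mrank (G_cut V m node is_in E \<Omega> :: 'a mat)"
  shows "m + c \<le> minor_dim N I K + card (indices - I)"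
proof -
  define J where "J = {j. Inl j \<in> I}"
  have J: "J \<subseteq> {..<m}" using I by (auto simp: J_def)
  have fI: "finite I" using I finite_subset by blast
  have le: "card J + card D \<le> minor_dim N I K" if "finite D" "Inr ` D \<subseteq> K" for D
    using minor_dim_ports[OF J that(1), of "\<lambda>_ _. 0 :: 'a" "\<lambda>_ _. 0" "\<lambda>_ _. 0"]
      minor_dim_mono[of "Inl ` J" I "Inr ` D" K N] that K fI
    unfolding N_def J_def by auto
  have cJ: "card ({..<m} - J) = m - card J" "card J \<le> m"
    using card_Diff_subset[OF finite_subset[OF J] J] card_mono[OF _ J] by auto
  consider (sink) "\<And>k. Inr k \<notin> I" | (source) "Inr ` {..<mu} \<subseteq> K"
    | (cut) s k where "Inr k \<in> I" "s < mu" "Inr s \<notin> K"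
    by auto
  then show ?thesis
  proof cases
    case sink
    then have "indices - I = Inl ` ({..<m} - J) \<union> Inr ` {..<nu}"
      by (auto simp: J_def)
    then have "card (indices - I) = (m - card J) + nu"
      using cJ(1) by (subst \<open>indices - I = _\<close>, subst card_Un_disjoint) (auto simp: card_image)
    then show ?thesis
      using le[of "{}"] c_nu cJ by simp
  next
    case source
    have "card (Inl ` ({..<m} - J) :: (nat + nat) set) \<le> card (indices - I)"
      by (intro card_mono) (auto simp: J_def)
    then show ?thesis
      using le[of "{..<mu}"] source c_mu cJ by (simp add: card_image)
  next
    case cut
    have kT: "k < nu" using cut I by auto
    \<comment> \<open>\<Omega> collects the supernodes other than \<open>T\<close> with no output
      column in \<open>I\<close>. The coordinate \<open>s\<close> outside \<open>K\<close> puts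
      \<open>S\<close> there, and every input port outside \<Omega> is forced into \<open>K\<close>:
      through \<open>k\<close> at \<open>T\<close>, through an output column in \<open>I\<close>
      elsewhere.\<close>
    define \<Omega> where "\<Omega> = {v \<in> V. v \<noteq> T \<and> (\<forall>j<m. \<not> is_in j \<and> node j = v \<longrightarrow> Inl j \<notin> I)}"
    have no_S: "Inl j \<notin> I" if "j < m" "\<not> is_in j" "node j = S" for j
      using free cut that unfolding free_entries_def by blast
    have \<Omega>: "\<Omega> \<subseteq> V" "S \<in> \<Omega>" "T \<notin> \<Omega>"
      using source distinct no_S by (auto simp: \<Omega>_def)
    have sub: "I \<subseteq> cut_cols \<Omega>"
    proof
      fix y assume "y \<in> I"
      then show "y \<in> cut_cols \<Omega>"
        using I by (cases y) (auto simp: cut_cols_def \<Omega>_def inj_image_mem_iff)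
    qed
    have rows: "cut_rows \<Omega> \<subseteq> K"
    proof
      fix y assume "y \<in> cut_rows \<Omega>"
      then obtain i where i: "y = Inl i" "i < m" "is_in i" "node i \<notin> \<Omega>"
        by (auto simp: cut_rows_def)
      show "y \<in> K"
      proof (cases "node i = T")
        case True
        then have "(Inr k, Inl i) \<in> free_entries"
          using i kT by simp
        from bspec[OF free this] show ?thesis
          using cut i(1) by simp
      next
        case False
        then obtain j where j: "j < m" "\<not> is_in j" "node j = node i" "Inl j \<in> I"
          using i node_V by (auto simp: \<Omega>_def)
        then have "(Inl j, Inl i) \<in> free_entries"
          using i by simp
        from bspec[OF free this] show ?thesis
          using j i(1) by simp
      qed
    qed
    \<comment> \<open>Moving to the cut pair enlarges \<open>I\<close> and shrinks \<open>K\<close>: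
      each new column adds at most one to the dimension and takes one off the count of missing
      columns.\<close>
    have "minor_dim N (cut_cols \<Omega>) (cut_rows \<Omega>) \<le> minor_dim N I (cut_rows \<Omega>) + card (cut_cols \<Omega> - I)"
      by (intro minor_dim_extend sub finite_cut)
    also have "minor_dim N I (cut_rows \<Omega>) \<le> minor_dim N I K"
      by (intro minor_dim_mono rows fI K) auto
    finally have "minor_dim N (cut_cols \<Omega>) (cut_rows \<Omega>) \<le> minor_dim N I K + card (cut_cols \<Omega> - I)"
      by simp
    moreover have "card (indices - I) = card (indices - cut_cols \<Omega>) + card (cut_cols \<Omega> - I)"
    proof -
      have "indices - I = (indices - cut_cols \<Omega>) \<union> (cut_cols \<Omega> - I)"
        using sub finite_cut(3)[of \<Omega>] by blast
      then show ?thesis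
        by (subst \<open>indices - I = _\<close>, intro card_Un_disjoint) (auto simp: finite_cut)
    qed
    ultimately show ?thesis
      using minor_dim_cut[OF \<Omega>(2,3), of "\<lambda>_ _. 0 :: 'a" "\<lambda>_ _. 0" "\<lambda>_ _. 0"] c_cut[OF \<Omega>] unfolding N_def by linarith
  qed
qed

text \<open>The maximal completion is the block matrix of some code, and its witnessing pair costs
  at least \<open>m + c\<close>; subtracting \<open>m\<close> leaves the bound on the rank of
  M.\<close>

lemma system_rank_attained:
  assumes "c \<le> mu" "c \<le> nu"
    and "\<And>\<Omega>. \<Omega> \<subseteq> V \<Longrightarrow> S \<in> \<Omega> \<Longrightarrow> T \<notin> \<Omega> \<Longrightarrow> c \<le> mrank (G_cut V m node is_in E \<Omega> :: 'a::field mat)"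
  obtains \<alpha> \<beta> \<epsilon> :: "nat \<Rightarrow> nat \<Rightarrow> 'a::field"
  where "c \<le> mrank (system_matrix mu nu m node is_in E S T \<alpha> \<beta> \<epsilon>)"
proof -
  let ?N = "column (\<lambda>_ _. 0) (\<lambda>_ _. 0) (\<lambda>_ _. 0) :: nat + nat \<Rightarrow> nat + nat \<Rightarrow> 'a"
  obtain x I K where x: "agree_off free_entries x ?N" and IK: "I \<subseteq> indices" "finite K"
    "\<forall>(i, k) \<in> free_entries. i \<in> I \<longrightarrow> k \<in> K"
    "minor_dim ?N I K + card (indices - I) \<le> minor_dim x indices {}"
    using max_rank_completion[OF finite_free_entries, of indices "{}" ?N] by auto
  obtain \<alpha> \<beta> \<epsilon> where "x = column \<alpha> \<beta> \<epsilon>"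
    using completion_is_column[OF x] .
  then have "c \<le> mrank (system_matrix mu nu m node is_in E S T \<alpha> \<beta> \<epsilon>)"
    using minor_ge_cut[OF IK(1-3) assms] IK(4) minor_dim_columns[of \<alpha> \<beta> \<epsilon>] by simp
  then show ?thesis using that by blast
qed

end

text \<open>A \<open>mu\<close> by \<open>nu\<close> matrix has rank at most \<open>mu\<close> and
  at most \<open>nu\<close>; the last two assumptions provide enough source processes and
  destination outputs for the cut value to be reached.\<close>

theorem theorem2:
  fixes V :: "'v set" and m mu nu :: nat and node :: "nat \<Rightarrow> 'v" and is_in :: "nat \<Rightarrow> bool"
    and E :: "(nat \<times> nat) set" and S T :: 'v
  assumes "adt_network V m node is_in E"
    and "S \<in> V" and "T \<in> V" and "S \<noteq> T"
    and "adt_mincut TYPE('a::{finite,field}) V m node is_in E S T \<le> mu"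
    and "adt_mincut TYPE('a) V m node is_in E S T \<le> nu"
  shows "adt_mincut TYPE('a) V m node is_in E S T
           = Min {mrank (G_cut V m node is_in E \<Omega> :: 'a mat) | \<Omega>. \<Omega> \<subseteq> V \<and> S \<in> \<Omega> \<and> T \<notin> \<Omega>}
       \<and> Min {mrank (G_cut V m node is_in E \<Omega> :: 'a mat) | \<Omega>. \<Omega> \<subseteq> V \<and> S \<in> \<Omega> \<and> T \<notin> \<Omega>}
           = Max {mrank (system_matrix mu nu m node is_in E S T \<alpha> \<beta> \<epsilon> :: 'a mat) | \<alpha> \<beta> \<epsilon>. True}"
proof
  interpret adt V m mu nu node is_in E S T
    using assms by unfold_locales
  let ?cuts = "{mrank (G_cut V m node is_in E \<Omega> :: 'a mat) | \<Omega>. \<Omega> \<subseteq> V \<and> S \<in> \<Omega> \<and> T \<notin> \<Omega>}"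
  let ?ranks = "{mrank (system_matrix mu nu m node is_in E S T \<alpha> \<beta> \<epsilon> :: 'a mat) | \<alpha> \<beta> \<epsilon>. True}"
  show eq: "adt_mincut TYPE('a) V m node is_in E S T = Min ?cuts"
    by (simp add: adt_mincut_def)
  have "finite V" using assms(1) by (simp add: adt_network_def)
  moreover have cuts: "?cuts = (\<lambda>\<Omega>. mrank (G_cut V m node is_in E \<Omega> :: 'a mat)) ` {\<Omega>. \<Omega> \<subseteq> V \<and> S \<in> \<Omega> \<and> T \<notin> \<Omega>}"
    by blast
  ultimately have fin: "finite ?cuts"
    by (simp only: cuts) (intro finite_imageI, simp)
  \<comment> \<open>The cut \<open>{S}\<close> ensures that the minimum is taken over a nonempty
    set.\<close>
  have "{S} \<subseteq> V \<and> S \<in> {S} \<and> T \<notin> {S}"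
    using assms(2,4) by auto
  then have ne: "?cuts \<noteq> {}"
    by blast
  have le: "r \<le> Min ?cuts" if r: "r \<in> ?ranks" for r
  proof (intro Min.boundedI[OF fin ne])
    fix c assume "c \<in> ?cuts"
    with r show "r \<le> c"
      using system_rank_le_cut by auto
  qed
  have cut_le: "Min ?cuts \<le> mrank (G_cut V m node is_in E \<Omega> :: 'a mat)"
    if "\<Omega> \<subseteq> V" "S \<in> \<Omega>" "T \<notin> \<Omega>" for \<Omega>
    using that by (intro Min_le[OF fin]) blast
  obtain \<alpha> \<beta> \<epsilon> :: "nat \<Rightarrow> nat \<Rightarrow> 'a"
    where ge: "Min ?cuts \<le> mrank (system_matrix mu nu m node is_in E S T \<alpha> \<beta> \<epsilon>)"
    using system_rank_attained[OF assms(5,6)[unfolded eq] cut_le] by blast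
  have mem: "mrank (system_matrix mu nu m node is_in E S T \<alpha> \<beta> \<epsilon>) \<in> ?ranks"
    by blast
  have "Min ?cuts \<in> ?ranks"
    using antisym[OF ge le[OF mem]] mem by (simp only:)
  \<comment> \<open>The coefficients range over infinitely many functions; the ranks form a finite
    set because the cut value bounds them, so \<open>Max\<close> is meaningful.\<close>
  moreover have "finite ?ranks"
    using le by (rule bounded_nat_set_is_finite[of _ "Suc (Min ?cuts)", OF ballI, OF le_imp_less_Suc])
  ultimately show "Min ?cuts = Max ?ranks"
    using le by (intro Max_eqI[symmetric])
qed

end
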